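(* For every integer $k>0$, the space $\mathbb{Y}(\mathcal{I}^k)$ has an analytic topology, is nodec, and is crowded (has no isolated points).
   Context: $\mathbb{N}=\{0,1,2,\dots\}$; $2^{\mathbb{N}}$ is the Cantor space, and subsets of $\mathbb{N}$ are identified with their characteristic functions in $2^{\mathbb{N}}$. For a finite binary sequence $s\in 2^{<\omega}$ let $[s]=\{\alpha\in 2^{\mathbb{N}}:\alpha(i)=s(i)\text{ for all }i<|s|\}$. For nonempty $\mathcal{A}\subseteq 2^{\mathbb{N}}$, $\rho_{\mathcal{A}}$ is the topology on $2^{2^{\mathbb{N}}\times\mathbb{N}}$ generated by the subbasic sets $(\alpha,p)^+=\{\theta:\theta(\alpha,p)=1\}$ and $(\alpha,p)^-=\{\theta:\theta(\alpha,p)=0\}$ with $\alpha\in\mathcal{A}$, $p\in\mathbb{N}$. Let $\mathbb{X}$ be the countable set of all finite unions of sets $[s]\times\{n\}$ ($s\in 2^{<\omega}$, $n\in\mathbb{N}$), including $\emptyset$, viewed (via characteristic functions) as a subset of $2^{2^{\mathbb{N}}\times\mathbb{N}}$. Fix a one-to-one enumeration $\{\varphi_n:n\in\mathbb{N}\}$ of $\mathbb{X}$ with $\varphi_0=\emptyset$. Define $\psi_n:2^{\mathbb{N}}\times\mathbb{N}\to\{0,1\}$ by $\psi_n(\alpha,m)=\varphi_n(\alpha,m)$ if $\alpha(n)=0$ and $\psi_n(\alpha,m)=1$ if $\alpha(n)=1$; let $\mathbb{Y}=\{\psi_n:n\in\mathbb{N}\}$. $\mathbb{X}(\mathcal{I})=(\mathbb{X},\rho_{\mathcal{I}})$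 and $\mathbb{Y}(\mathcal{I})=(\mathbb{Y},\rho_{\mathcal{I}})$ (subspace topologies). For nonempty $\mathcal{I}\subseteq 2^{\mathbb{N}}$ let $\mathcal{I}^{\star}=\{F\subseteq\mathbb{N}:\{\varphi_n:n\in F\}\text{ is nowhere dense in }\mathbb{X}(\mathcal{I})\}$. Define $\mathcal{I}^0=2^{\mathbb{N}}$ and $\mathcal{I}^k=(\mathcal{I}^{k-1})^{\star}$ for $k>0$. A space is nodec if every nowhere dense set is closed. A topology on a countable set $Z$ is analytic if it is an analytic subset of $2^Z$ (identifying subsets of $Z$ with characteristic functions). *)

theory Defs
  imports "HOL-Analysis.Analysis"
begin

section \<open>Analytic sets, analytic topologies, nodec and crowded spaces\<close>

text \<open>A set is analytic if it is empty or a continuous image of the Baire space; for subsets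
  of a Polish space this is the same as being a continuous image of a Polish space.\<close>

definition baire_space :: "(nat \<Rightarrow> nat) topology" where
  "baire_space = product_topology (\<lambda>_. discrete_topology UNIV) UNIV"

definition analytic_in :: "'a topology \<Rightarrow> 'a set \<Rightarrow> bool" where
  "analytic_in T A \<longleftrightarrow>
     A \<subseteq> topspace T \<and>
     (A = {} \<or> (\<exists>f. continuous_map baire_space T f \<and> f ` topspace baire_space = A))"

text \<open>The space \<open>2\<^sup>Z\<close>; its points are the extensional functions on \<open>Z\<close>, so each subset of \<open>Z\<close>
  has exactly one characteristic function in it.\<close>

definition cantor_cube :: "'a set \<Rightarrow> ('a \<Rightarrow> bool) topology" where
  "cantor_cube Z = product_topology (\<lambda>_. discrete_topology UNIV) Z"

definition char_fun :: "'a set \<Rightarrow> 'a set \<Rightarrow> 'a \<Rightarrow> bool" where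
  "char_fun Z U = (\<lambda>z\<in>Z. z \<in> U)"

definition has_analytic_topology :: "'a topology \<Rightarrow> bool" where
  "has_analytic_topology T \<longleftrightarrow>
     countable (topspace T) \<and>
     analytic_in (cantor_cube (topspace T)) (char_fun (topspace T) ` {U. openin T U})"

definition nowhere_dense_in :: "'a topology \<Rightarrow> 'a set \<Rightarrow> bool" where
  "nowhere_dense_in T S \<longleftrightarrow> S \<subseteq> topspace T \<and> T interior_of (T closure_of S) = {}"

definition nodec_space :: "'a topology \<Rightarrow> bool" where
  "nodec_space T \<longleftrightarrow> (\<forall>S. nowhere_dense_in T S \<longrightarrow> closedin T S)"

definition crowded_space :: "'a topology \<Rightarrow> bool" where
  "crowded_space T \<longleftrightarrow> \<not> (\<exists>x\<in>topspace T. openin T {x})"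

section \<open>The spaces \<open>\<X>(\<I>)\<close> and \<open>\<Y>(\<I>)\<close>\<close>

text \<open>Subsets of \<open>\<nat>\<close> are identified with their characteristic functions throughout.\<close>

type_synonym cantor = "nat \<Rightarrow> bool"
type_synonym point = "cantor \<times> nat \<Rightarrow> bool"

definition cyl :: "bool list \<Rightarrow> cantor set" where
  "cyl s = {\<alpha>. \<forall>i<length s. \<alpha> i = s ! i}"

text \<open>For empty \<open>\<A>\<close> the generating family is empty and so is the carrier of \<open>rho \<A>\<close>; the
  definition is meant for nonempty \<open>\<A>\<close> only, where the carrier is everything.\<close>

definition rho :: "cantor set \<Rightarrow> point topology" where
  "rho \<A> = topology_generated_by
     ({{\<theta>. \<theta> (\<alpha>, p)} | \<alpha> p. \<alpha> \<in> \<A>} \<union> {{\<theta>. \<not> \<theta> (\<alpha>, p)} | \<alpha> p. \<alpha> \<in> \<A>})"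

definition XX :: "point set" where
  "XX = {\<lambda>z. z \<in> (\<Union>(s, n)\<in>P. cyl s \<times> {n}) | P. finite P}"

definition enumerates_XX :: "(nat \<Rightarrow> point) \<Rightarrow> bool" where
  "enumerates_XX \<phi> \<longleftrightarrow> bij_betw \<phi> UNIV XX \<and> \<phi> 0 = (\<lambda>_. False)"

definition psi :: "(nat \<Rightarrow> point) \<Rightarrow> nat \<Rightarrow> point" where
  "psi \<phi> n = (\<lambda>(\<alpha>, m). if \<alpha> n then True else \<phi> n (\<alpha>, m))"

definition YY :: "(nat \<Rightarrow> point) \<Rightarrow> point set" where
  "YY \<phi> = range (psi \<phi>)"

definition X_space :: "cantor set \<Rightarrow> point topology" where
  "X_space \<I> = subtopology (rho \<I>) XX"

definition Y_space :: "(nat \<Rightarrow> point) \<Rightarrow> cantor set \<Rightarrow> point topology" where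
  "Y_space \<phi> \<I> = subtopology (rho \<I>) (YY \<phi>)"

definition star :: "(nat \<Rightarrow> point) \<Rightarrow> cantor set \<Rightarrow> cantor set" where
  "star \<phi> \<I> = {F. nowhere_dense_in (X_space \<I>) {\<phi> n | n. F n}}"

primrec iter_star :: "(nat \<Rightarrow> point) \<Rightarrow> nat \<Rightarrow> cantor set" where
  "iter_star \<phi> 0 = UNIV"
| "iter_star \<phi> (Suc k) = star \<phi> (iter_star \<phi> k)"

end

(* Write agree K x y when the points x and y coincide on the set K of coordinates. Finite sets
   K \<subseteq> I \<times> \<nat> give the basic neighbourhoods of \<rho>\<^sub>I, and since \<X> is dense, F \<in> I\<^sup>\<star> can be tested on arbitrary
   points instead of elements of \<X>. This makes \<star> monotone, so the families I\<^sup>k decrease, and each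
   I\<^sup>k with k > 0 is an ideal containing the singletons.

   Let J = I\<^sup>\<star> \<subseteq> I. A coordinate set K over J only distorts \<phi>\<^sub>n into \<psi>\<^sub>n for n in the finite union D of
   the members of J occurring in K, and D is in J again, hence negligible in \<X>(I). Consequently a set of indices
   whose \<psi>-image is nowhere dense in \<Y>(J) lies in J, and then its \<psi>-image is closed, being the
   intersection of the sets (A,p)\<^sup>+. The same argument shows that \<Y>(J) is crowded.

   For analyticity, closing off under witnesses shows that F \<in> I\<^sup>\<star> iff F \<in> J\<^sup>\<star> for some countable
   J \<subseteq> I. Quantifying over an enumeration of J makes I\<^sup>\<star> a projection of a Borel condition together
   with the condition J \<subseteq> I, so analyticity passes from I to I\<^sup>\<star>, and then to the topology of \<Y>(I). *)
theory Submission
  imports Defs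
begin

section \<open>Analytic predicates\<close>

lemma open_seq_iff:
  fixes U :: "(nat \<Rightarrow> 'a::discrete_topology) set"
  shows "open U \<longleftrightarrow> (\<forall>x\<in>U. \<exists>n. \<forall>y. (\<forall>i<n. y i = x i) \<longrightarrow> y \<in> U)"
proof
  assume U: "open U"
  show "\<forall>x\<in>U. \<exists>n. \<forall>y. (\<forall>i<n. y i = x i) \<longrightarrow> y \<in> U"
  proof
    fix x assume "x \<in> U"
    moreover have "openin (product_topology (\<lambda>_. euclidean) UNIV) U"
      using U by (simp add: euclidean_product_topology)
    ultimately obtain X where X: "x \<in> (\<Pi>\<^sub>E i\<in>UNIV. X i)" "finite {i. X i \<noteq> (UNIV::'a set)}"
      "(\<Pi>\<^sub>E i\<in>UNIV. X i) \<subseteq> U"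
      using product_topology_open_contains_basis[of "\<lambda>_. euclidean" UNIV U x] by auto
    obtain n where n: "\<forall>i\<in>{i. X i \<noteq> (UNIV::'a set)}. i < n"
      using finite_nat_set_iff_bounded X(2) by blast
    have "y \<in> U" if "\<forall>i<n. y i = x i" for y
    proof -
      have "y i \<in> X i" for i
        using n X(1) that by (cases "i < n") (auto simp: PiE_iff)
      then show ?thesis using X(3) by auto
    qed
    then show "\<exists>n. \<forall>y. (\<forall>i<n. y i = x i) \<longrightarrow> y \<in> U" by blast
  qed
next
  assume R: "\<forall>x\<in>U. \<exists>n. \<forall>y. (\<forall>i<n. y i = x i) \<longrightarrow> y \<in> U"
  have basic: "open {y. \<forall>i<n. y i = x i}" for n and x :: "nat \<Rightarrow> 'a"
  proof -
    have "open ((\<lambda>y. y i) -` {x i})" for i :: nat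
      by (intro open_vimage open_discrete continuous_on_product_coordinates)
    then have "open (\<Inter>i\<in>{..<n}. (\<lambda>y. y i) -` {x i})"
      by (intro open_INT) auto
    moreover have "{y. \<forall>i<n. y i = x i} = (\<Inter>i\<in>{..<n}. (\<lambda>y. y i) -` {x i})" by auto
    ultimately show ?thesis by simp
  qed
  show "open U"
  proof (subst open_subopen, rule ballI)
    fix x assume "x \<in> U"
    then obtain n where "\<forall>y. (\<forall>i<n. y i = x i) \<longrightarrow> y \<in> U" using R by blast
    then show "\<exists>T. open T \<and> x \<in> T \<and> T \<subseteq> U"
      by (intro exI[of _ "{y. \<forall>i<n. y i = x i}"]) (auto intro: basic)
  qed
qed

lemma continuous_on_seq_locally_constant:
  fixes f :: "(nat \<Rightarrow> 'a::discrete_topology) \<Rightarrow> 'b::topological_space"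
  assumes "\<And>x. \<exists>n. \<forall>y. (\<forall>i<n. y i = x i) \<longrightarrow> f y = f x"
  shows "continuous_on UNIV f"
proof -
  have "open (f -` B)" for B
    unfolding open_seq_iff
  proof
    fix x assume "x \<in> f -` B"
    then show "\<exists>n. \<forall>y. (\<forall>i<n. y i = x i) \<longrightarrow> y \<in> f -` B"
      using assms[of x] by (metis vimageE vimageI2)
  qed
  then show ?thesis
    by (simp add: continuous_on_open_vimage)
qed

text \<open>A nonempty closed set is a retract. A sequence outside \<open>D\<close> has a longest
  prefix that still extends into \<open>D\<close>; it is sent to a chosen extension of that prefix,
  and the choice depends on the prefix only.\<close>

lemma closed_subset_baire_continuous_image:
  fixes D :: "(nat \<Rightarrow> 'a::discrete_topology) set"
  assumes "closed D" "D \<noteq> {}"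
  obtains r :: "(nat \<Rightarrow> 'a) \<Rightarrow> nat \<Rightarrow> 'a" where "continuous_on UNIV r" "range r = D"
proof -
  define near where "near n x = {y \<in> D. \<forall>i<n. y i = x i}" for n and x :: "nat \<Rightarrow> 'a"
  define pick where "pick x = (SOME y. y \<in> near ((LEAST n. near n x = {}) - 1) x)" for x
  define r where "r x = (if x \<in> D then x else pick x)" for x
  have near_cong: "near n x = near n y" if "\<forall>i<n. x i = y i" for n x y
    using that by (auto simp: near_def)
  have off: "\<exists>n. near n x = {}" if "x \<notin> D" for x
    using assms(1) that unfolding closed_def open_seq_iff near_def by (metis (mono_tags, lifting) ComplD ComplI empty_Collect_eq)
  have least: "near (Suc n) x = {}" "near n x \<noteq> {}" "pick x \<in> near n x"
    if "x \<notin> D" "(LEAST n. near n x = {}) = Suc n" for x n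
  proof -
    show "near (Suc n) x = {}"
      using LeastI_ex[OF off[OF that(1)]] that(2) by simp
    show "near n x \<noteq> {}"
      using not_less_Least[of n "\<lambda>n. near n x = {}"] that(2) by simp
    then show "pick x \<in> near n x"
      unfolding pick_def that(2) using some_in_eq by auto
  qed
  have pos: "\<exists>n. (LEAST n. near n x = {}) = Suc n" if "x \<notin> D" for x
  proof -
    have "near 0 x \<noteq> {}" using assms(2) by (simp add: near_def)
    then have "(LEAST n. near n x = {}) \<noteq> 0"
      using LeastI_ex[OF off[OF that]] by metis
    then show ?thesis using not0_implies_Suc by blast
  qed
  have "range r = D"
  proof
    show "range r \<subseteq> D"
    proof
      fix y assume "y \<in> range r"
      then obtain x where "y = r x" by blast
      then show "y \<in> D"
        using pos[of x] least(3)[of x] by (cases "x \<in> D") (auto simp: r_def near_def)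
    qed
    show "D \<subseteq> range r"
      by (metis r_def rangeI subsetI)
  qed
  moreover have "continuous_on UNIV r"
  proof (intro continuous_on_coordinatewise_then_product continuous_on_seq_locally_constant)
    fix m x
    show "\<exists>n. \<forall>y. (\<forall>i<n. y i = x i) \<longrightarrow> r y m = r x m"
    proof (cases "x \<in> D")
      case True
      have "r y m = r x m" if y: "\<forall>i<Suc m. y i = x i" for y
      proof (cases "y \<in> D")
        case False
        obtain n where n: "(LEAST n. near n y = {}) = Suc n" using pos[OF False] by blast
        have "x \<in> near (Suc m) y" using True y by (simp add: near_def)
        \<comment> \<open>The prefix of \<open>y\<close> of length \<open>Suc m\<close> extends into
          \<open>D\<close>, namely to \<open>x\<close>. Hence \<open>m < n\<close>, and
          \<open>pick y\<close> copies coordinate \<open>m\<close> of \<open>y\<close>.\<close>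
        then have "\<not> Suc n \<le> Suc m"
          using least(1)[OF False n] by (auto simp: near_def)
        then have "pick y m = y m"
          using least(3)[OF False n] by (simp add: near_def)
        then show ?thesis using True False y by (simp add: r_def)
      qed (use True y in \<open>simp add: r_def\<close>)
      then show ?thesis by blast
    next
      case False
      obtain n where n: "(LEAST n. near n x = {}) = Suc n" using pos[OF False] by blast
      have "r y m = r x m" if y: "\<forall>i<Suc n. y i = x i" for y
      proof -
        \<comment> \<open>The first \<open>Suc n\<close> values fix all sets \<open>near k\<close>
          with \<open>k \<le> Suc n\<close>, hence both the least length and the set from which
          \<open>SOME\<close> picks.\<close>
        have eq: "near k y = near k x" if "k \<le> Suc n" for k
          using near_cong[of k y x] y that by auto
        have "y \<notin> D"
          using least(1)[OF False n] eq[of "Suc n"] by (auto simp: near_def)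
        moreover have "(LEAST n. near n y = {}) = Suc n"
        proof (rule Least_equality)
          show "near (Suc n) y = {}" using eq least(1)[OF False n] by simp
          fix k assume "near k y = {}"
          then show "Suc n \<le> k"
            using eq[of k] n Least_le[of "\<lambda>n. near n x = {}" k] by (metis nat_le_linear)
        qed
        ultimately show ?thesis
          using False n eq[of n] by (simp add: r_def pick_def)
      qed
      then show ?thesis by blast
    qed
  qed
  ultimately show ?thesis by (rule that[rotated])
qed

text \<open>Projections along the Baire space rather than its continuous images: in this form countable
  intersections need no separation axiom.\<close>

definition Sigma11 :: "('a::topological_space \<Rightarrow> bool) \<Rightarrow> bool" where
  "Sigma11 P \<longleftrightarrow> (\<exists>C. closed C \<and> (\<forall>x. P x \<longleftrightarrow> (\<exists>f::nat \<Rightarrow> nat. (x, f) \<in> C)))"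

section \<open>Clopen predicates and closure properties of \<open>Sigma11\<close>\<close>

lemma continuous_on_discrete_range:
  fixes P :: "'a::topological_space \<Rightarrow> 'b::discrete_topology"
  assumes "continuous_on UNIV P"
  shows "closed (P -` B)"
  using assms by (intro closed_vimage) (simp_all add: closed_def open_discrete)

text \<open>Clopen predicates are represented as continuous maps into \<open>bool\<close>. A
  preimage under a two-place operation is a union of intersections of open fibres, which settles all
  connectives at once.\<close>

lemma continuous_on_discrete2:
  fixes P :: "'a::topological_space \<Rightarrow> 'b::discrete_topology" and Q :: "'a \<Rightarrow> 'c::discrete_topology"
    and F :: "'b \<Rightarrow> 'c \<Rightarrow> 'd::topological_space"
  assumes "continuous_on UNIV P" "continuous_on UNIV Q"
  shows "continuous_on UNIV (\<lambda>x. F (P x) (Q x))"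
proof -
  have "open ((\<lambda>x. F (P x) (Q x)) -` B)" for B
  proof -
    have "(\<lambda>x. F (P x) (Q x)) -` B = (\<Union>a. \<Union>b\<in>{b. F a b \<in> B}. P -` {a} \<inter> Q -` {b})"
      by auto
    then show ?thesis
      using assms by (auto intro!: open_UN open_Int open_vimage open_discrete)
  qed
  then show ?thesis
    by (simp add: continuous_on_open_vimage)
qed

lemma continuous_on_eq_discrete:
  fixes P Q :: "'a::topological_space \<Rightarrow> 'b::discrete_topology"
  shows "continuous_on UNIV P \<Longrightarrow> continuous_on UNIV Q \<Longrightarrow> continuous_on UNIV (\<lambda>x. P x = Q x)"
  by (rule continuous_on_discrete2[of P Q "(=)"])

lemma continuous_on_disj:
  fixes P Q :: "'a::topological_space \<Rightarrow> bool"
  shows "continuous_on UNIV P \<Longrightarrow> continuous_on UNIV Q \<Longrightarrow> continuous_on UNIV (\<lambda>x. P x \<or> Q x)"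
  by (rule continuous_on_discrete2[of P Q "(\<or>)"])

lemma continuous_on_imp:
  fixes P Q :: "'a::topological_space \<Rightarrow> bool"
  shows "continuous_on UNIV P \<Longrightarrow> continuous_on UNIV Q \<Longrightarrow> continuous_on UNIV (\<lambda>x. P x \<longrightarrow> Q x)"
  by (rule continuous_on_discrete2[of P Q "(\<longrightarrow>)"])

lemma continuous_on_not:
  fixes P :: "'a::topological_space \<Rightarrow> bool"
  shows "continuous_on UNIV P \<Longrightarrow> continuous_on UNIV (\<lambda>x. \<not> P x)"
  using continuous_on_discrete2[of P P "\<lambda>p _. \<not> p"] by simp

lemma continuous_on_all_less:
  fixes P :: "nat \<Rightarrow> 'a::topological_space \<Rightarrow> bool"
  assumes "\<And>i. continuous_on UNIV (P i)"
  shows "continuous_on UNIV (\<lambda>x. \<forall>i<N. P i x)"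
proof (induction N)
  case (Suc N)
  then show ?case
    unfolding All_less_Suc using continuous_on_discrete2[of "P N" "\<lambda>x. \<forall>i<N. P i x" "(\<and>)"] assms by simp
qed simp

lemma Sigma11_clopen:
  fixes P :: "'a::topological_space \<Rightarrow> bool"
  assumes "continuous_on UNIV P"
  shows "Sigma11 P"
proof -
  have "closed (P -` {True} \<times> (UNIV :: (nat \<Rightarrow> nat) set))"
    using continuous_on_discrete_range[OF assms] by (intro closed_Times) auto
  then show ?thesis
    unfolding Sigma11_def by (intro exI[of _ "P -` {True} \<times> UNIV"]) auto
qed

lemma Sigma11_compose:
  assumes "Sigma11 P" "continuous_on UNIV g"
  shows "Sigma11 (\<lambda>x. P (g x))"
proof -
  obtain C where C: "closed C" "\<forall>x. P x \<longleftrightarrow> (\<exists>f::nat \<Rightarrow> nat. (x, f) \<in> C)"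
    using assms(1) by (auto simp: Sigma11_def)
  have "closed ((\<lambda>(x, f). (g x, f)) -` C)"
    using C(1) unfolding case_prod_unfold
    by (intro closed_vimage continuous_intros continuous_on_compose2[OF assms(2)]) auto
  then show ?thesis
    unfolding Sigma11_def using C(2) by (intro exI[of _ "(\<lambda>(x, f). (g x, f)) -` C"]) auto
qed

lemma continuous_on_reindex [continuous_intros]:
  "continuous_on UNIV f \<Longrightarrow> continuous_on UNIV (\<lambda>x n. f x (\<sigma> n))"
  by (intro continuous_on_coordinatewise_then_product) (rule continuous_on_product_then_coordinatewise)

text \<open>One sequence codes a witness for every \<open>n\<close>, row \<open>n\<close> being read
  through \<open>prod_encode\<close>; the condition on each row is closed.\<close>

lemma Sigma11_all:
  fixes P :: "nat \<Rightarrow> 'a::topological_space \<Rightarrow> bool"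
  assumes "\<And>n. Sigma11 (P n)"
  shows "Sigma11 (\<lambda>x. \<forall>n. P n x)"
proof -
  obtain C where C: "\<And>n. closed (C n)" "\<And>n x. P n x \<longleftrightarrow> (\<exists>f::nat \<Rightarrow> nat. (x, f) \<in> C n)"
    using assms unfolding Sigma11_def by metis
  let ?D = "\<Inter>n. (\<lambda>(x, f). (x, \<lambda>i. f (prod_encode (n, i)))) -` C n"
  have "closed ?D"
    using C(1) unfolding case_prod_unfold
    by (intro closed_INT ballI closed_vimage continuous_intros)
  moreover have "(\<forall>n. P n x) \<longleftrightarrow> (\<exists>f. (x, f) \<in> ?D)" for x
  proof
    assume "\<forall>n. P n x"
    then have "\<forall>n. \<exists>f. (x, f) \<in> C n" using C(2) by simp
    then obtain f where "\<forall>n. (x, f n) \<in> C n"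
      using choice[of "\<lambda>n f. (x, f) \<in> C n"] by blast
    then show "\<exists>f. (x, f) \<in> ?D"
      by (intro exI[of _ "\<lambda>j. case_prod f (prod_decode j)"]) simp
  qed (use C(2) in auto)
  ultimately show ?thesis unfolding Sigma11_def by blast
qed

text \<open>The witness starts with \<open>n\<close> itself. Requiring for every \<open>n\<close>
  that \<open>f 0\<close> differs from \<open>n\<close> or the tail lies in \<open>C n\<close> gives
  an intersection of closed sets, whereas a plain union over \<open>n\<close> need not be
  closed.\<close>

lemma Sigma11_ex:
  fixes P :: "nat \<Rightarrow> 'a::topological_space \<Rightarrow> bool"
  assumes "\<And>n. Sigma11 (P n)"
  shows "Sigma11 (\<lambda>x. \<exists>n. P n x)"
proof -
  obtain C where C: "\<And>n. closed (C n)" "\<And>n x. P n x \<longleftrightarrow> (\<exists>f::nat \<Rightarrow> nat. (x, f) \<in> C n)"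
    using assms unfolding Sigma11_def by metis
  let ?D = "\<Inter>n. (\<lambda>(x, f). f 0) -` (- {n}) \<union> (\<lambda>(x, f). (x, \<lambda>i. f (Suc i))) -` C n"
  have "closed ?D"
    using C(1) unfolding case_prod_unfold
    by (intro closed_INT ballI closed_Un continuous_on_discrete_range closed_vimage continuous_intros
        continuous_on_product_then_coordinatewise)
  moreover have "(\<exists>n. P n x) \<longleftrightarrow> (\<exists>f. (x, f) \<in> ?D)" for x
  proof
    assume "\<exists>n. P n x"
    then obtain n f where f: "(x, f) \<in> C n" using C(2) by metis
    then show "\<exists>f. (x, f) \<in> ?D" by (intro exI[of _ "case_nat n f"]) auto
  next
    assume "\<exists>f. (x, f) \<in> ?D"
    then obtain f where f: "(x, f) \<in> ?D" by blast
    then have "(x, \<lambda>i. f (Suc i)) \<in> C (f 0)" by auto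
    then show "\<exists>n. P n x" using C(2) by blast
  qed
  ultimately show ?thesis unfolding Sigma11_def by blast
qed

lemma Sigma11_conj:
  assumes "Sigma11 P" "Sigma11 Q"
  shows "Sigma11 (\<lambda>x. P x \<and> Q x)"
proof -
  have "Sigma11 (\<lambda>x. \<forall>n::nat. (if n = 0 then P else Q) x)"
    using assms by (intro Sigma11_all) auto
  moreover have "(\<lambda>x. \<forall>n::nat. (if n = 0 then P else Q) x) = (\<lambda>x. P x \<and> Q x)"
    by (auto simp: fun_eq_iff split: if_splits)
  ultimately show ?thesis by simp
qed

lemma Sigma11_disj:
  assumes "Sigma11 P" "Sigma11 Q"
  shows "Sigma11 (\<lambda>x. P x \<or> Q x)"
proof -
  have "Sigma11 (\<lambda>x. \<exists>n::nat. (if n = 0 then P else Q) x)"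
    using assms by (intro Sigma11_ex) auto
  moreover have "(\<lambda>x. \<exists>n::nat. (if n = 0 then P else Q) x) = (\<lambda>x. P x \<or> Q x)"
    by (auto simp: fun_eq_iff split: if_splits)
  ultimately show ?thesis by simp
qed

text \<open>Even positions code \<open>y\<close> through \<open>h\<close>, odd positions carry the
  witness for \<open>P (x, y)\<close>. Thus a quantifier over another space is absorbed into the one
  over the Baire space.\<close>

lemma Sigma11_project:
  fixes P :: "'a::topological_space \<times> 'b::topological_space \<Rightarrow> bool"
    and h :: "(nat \<Rightarrow> nat) \<Rightarrow> 'b"
  assumes "Sigma11 P" "continuous_on UNIV h" "surj h"
  shows "Sigma11 (\<lambda>x. \<exists>y. P (x, y))"
proof -
  obtain C where C: "closed C" "\<And>x. P x \<longleftrightarrow> (\<exists>f::nat \<Rightarrow> nat. (x, f) \<in> C)"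
    using assms(1) unfolding Sigma11_def by metis
  let ?t = "\<lambda>(x, f). ((x, h (\<lambda>i. f (2 * i))), \<lambda>i. f (Suc (2 * i)))"
  have "continuous_on UNIV (\<lambda>z :: 'a \<times> (nat \<Rightarrow> nat). \<lambda>i. snd z (2 * i))"
    by (intro continuous_intros)
  then have "continuous_on UNIV (\<lambda>z :: 'a \<times> (nat \<Rightarrow> nat). h (\<lambda>i. snd z (2 * i)))"
    by (rule continuous_on_compose2[OF assms(2)]) simp
  then have "closed (?t -` C)"
    using C(1) unfolding case_prod_unfold by (intro closed_vimage continuous_intros)
  moreover have "(\<exists>y. P (x, y)) \<longleftrightarrow> (\<exists>f. (x, f) \<in> ?t -` C)" for x
  proof
    assume "\<exists>y. P (x, y)"
    then obtain f g where "((x, h g), f) \<in> C" using C(2) assms(3) by (metis surjD)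
    then show "\<exists>f. (x, f) \<in> ?t -` C"
      by (intro exI[of _ "\<lambda>j. if even j then g (j div 2) else f (j div 2)"]) simp
  qed (use C(2) in auto)
  ultimately show ?thesis unfolding Sigma11_def by blast
qed

text \<open>The link from \<open>Sigma11\<close> to the continuous images in
  \<open>analytic_in\<close>: codes of points interleaved with their witnesses form a closed subset
  of the Baire space, hence a continuous image of it.\<close>

lemma Sigma11_continuous_image:
  fixes P :: "'a::topological_space \<Rightarrow> bool" and h :: "(nat \<Rightarrow> nat) \<Rightarrow> 'a"
  assumes "Sigma11 P" "\<exists>x. P x" "continuous_on UNIV h" "surj h"
  obtains r :: "(nat \<Rightarrow> nat) \<Rightarrow> 'a" where "continuous_on UNIV r" "range r = Collect P"
proof -
  obtain C where C: "closed C" "\<And>x. P x \<longleftrightarrow> (\<exists>f::nat \<Rightarrow> nat. (x, f) \<in> C)"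
    using assms(1) unfolding Sigma11_def by metis
  let ?t = "\<lambda>f. (h (\<lambda>i. f (2 * i)), \<lambda>i. f (Suc (2 * i)))"
  have t: "continuous_on UNIV (\<lambda>f. h (\<lambda>i. f (2 * i)))"
    by (rule continuous_on_compose2[OF assms(3)]) (auto intro: continuous_intros)
  have cl: "closed (?t -` C)"
    using C(1) t by (intro closed_vimage continuous_intros) auto
  have P: "P x \<longleftrightarrow> (\<exists>f. x = h (\<lambda>i. f (2 * i)) \<and> f \<in> ?t -` C)" for x
  proof
    assume "P x"
    then obtain f g where x: "x = h g" "(h g, f) \<in> C" using C(2) assms(4) by (metis surjD)
    let ?f = "\<lambda>j. if even j then g (j div 2) else f (j div 2)"
    show "\<exists>f. x = h (\<lambda>i. f (2 * i)) \<and> f \<in> ?t -` C"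
      using x by (intro exI[of _ ?f]) simp
  qed (use C(2) in auto)
  then have "?t -` C \<noteq> {}" using assms(2) by blast
  then obtain r :: "(nat \<Rightarrow> nat) \<Rightarrow> nat \<Rightarrow> nat" where r: "continuous_on UNIV r" "range r = ?t -` C"
    by (rule closed_subset_baire_continuous_image[OF cl])
  have "continuous_on UNIV (\<lambda>f. h (\<lambda>i. r f (2 * i)))"
    by (rule continuous_on_compose2[OF t r(1)]) simp
  moreover have "range (\<lambda>f. h (\<lambda>i. r f (2 * i))) = Collect P"
  proof -
    have "range (\<lambda>f. h (\<lambda>i. r f (2 * i))) = (\<lambda>f. h (\<lambda>i. f (2 * i))) ` range r"
      by (simp add: image_image)
    also have "\<dots> = Collect P" unfolding r(2) set_eq_iff mem_Collect_eq P image_iff Bex_def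
      by (simp add: conj_commute)
    finally show ?thesis .
  qed
  ultimately show ?thesis by (rule that)
qed

section \<open>Codings of the Cantor space and of its sequences\<close>

definition to_cantor_seq :: "(nat \<Rightarrow> nat) \<Rightarrow> nat \<Rightarrow> cantor" where
  "to_cantor_seq f = (\<lambda>i j. f (prod_encode (i, j)) = 0)"

text \<open>Zero stands for \<open>True\<close> and every other value for \<open>False\<close>, so
  each sequence of naturals is a code.\<close>

definition to_cantor :: "(nat \<Rightarrow> nat) \<Rightarrow> cantor" where
  "to_cantor f = (\<lambda>i. f i = 0)"

lemma continuous_on_coordinate_eq: "continuous_on UNIV (\<lambda>f :: nat \<Rightarrow> nat. f k = c)"
proof (rule continuous_on_seq_locally_constant)
  fix f :: "nat \<Rightarrow> nat"
  show "\<exists>n. \<forall>g. (\<forall>i<n. g i = f i) \<longrightarrow> (g k = c) = (f k = c)"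
    by (intro exI[of _ "Suc k"]) auto
qed

lemma continuous_to_cantor_seq: "continuous_on UNIV to_cantor_seq"
  unfolding to_cantor_seq_def
  by (intro continuous_on_coordinatewise_then_product continuous_on_coordinate_eq)

lemma continuous_to_cantor: "continuous_on UNIV to_cantor"
  unfolding to_cantor_def
  by (intro continuous_on_coordinatewise_then_product continuous_on_coordinate_eq)

lemma surj_to_cantor: "surj to_cantor"
proof (rule surjI)
  show "to_cantor (\<lambda>i. if \<beta> i then 0 else 1) = \<beta>" for \<beta>
    by (auto simp: to_cantor_def)
qed

lemma surj_to_cantor_seq: "surj to_cantor_seq"
proof (rule surjI)
  show "to_cantor_seq (\<lambda>k. case prod_decode k of (i, j) \<Rightarrow> if \<alpha> i j then 0 else 1) = \<alpha>" for \<alpha>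
    by (auto simp: to_cantor_seq_def)
qed

lemma discrete_topology_eq_euclidean: "discrete_topology UNIV = (euclidean :: 'a::discrete_topology topology)"
  by (simp add: topology_eq open_discrete)

lemma baire_space_eq_euclidean: "baire_space = euclidean"
  unfolding baire_space_def discrete_topology_eq_euclidean by (rule euclidean_product_topology)

section \<open>Neighbourhoods and nowhere dense sets\<close>

definition agree :: "'a set \<Rightarrow> ('a \<Rightarrow> 'b) \<Rightarrow> ('a \<Rightarrow> 'b) \<Rightarrow> bool" where
  "agree K x y \<longleftrightarrow> (\<forall>z\<in>K. x z = y z)"

lemma agree_refl [simp]: "agree K x x"
  and agree_empty [simp]: "agree {} x y"
  and agree_insert [simp]: "agree (insert z K) x y \<longleftrightarrow> x z = y z \<and> agree K x y"
  and agree_Un [simp]: "agree (K \<union> L) x y \<longleftrightarrow> agree K x y \<and> agree L x y"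
  by (auto simp: agree_def)

lemma agree_trans: "agree K x y \<Longrightarrow> agree K y z \<Longrightarrow> agree K x z"
  by (auto simp: agree_def)

definition fin_coords :: "cantor set \<Rightarrow> (cantor \<times> nat) set set" where
  "fin_coords I = {K. finite K \<and> K \<subseteq> I \<times> UNIV}"

lemma fin_coords_empty [simp]: "{} \<in> fin_coords I"
  by (simp add: fin_coords_def)

lemma fin_coords_insert [simp]: "insert z K \<in> fin_coords I \<longleftrightarrow> fst z \<in> I \<and> K \<in> fin_coords I"
  by (cases z) (auto simp: fin_coords_def)

lemma fin_coords_Un [simp]: "K \<union> L \<in> fin_coords I \<longleftrightarrow> K \<in> fin_coords I \<and> L \<in> fin_coords I"
  by (auto simp: fin_coords_def)

lemma fin_coords_mono: "J \<subseteq> I \<Longrightarrow> K \<in> fin_coords J \<Longrightarrow> K \<in> fin_coords I"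
  by (auto simp: fin_coords_def)

lemma fin_coords_finite: "K \<in> fin_coords I \<Longrightarrow> finite K"
  by (simp add: fin_coords_def)

lemma fin_coords_fst: "K \<in> fin_coords I \<Longrightarrow> z \<in> K \<Longrightarrow> fst z \<in> I"
  by (auto simp: fin_coords_def)

lemma fin_coords_restrict: "K \<in> fin_coords I \<Longrightarrow> K \<inter> J \<times> UNIV \<in> fin_coords J"
  by (auto simp: fin_coords_def)

lemma topspace_rho: "I \<noteq> {} \<Longrightarrow> topspace (rho I) = UNIV"
  unfolding rho_def topology_generated_by_topspace by auto

lemma openin_rho_coordinate:
  assumes "\<alpha> \<in> I"
  shows "openin (rho I) {y. x (\<alpha>, p) = y (\<alpha>, p)}"
proof (cases "x (\<alpha>, p)")
  case True
  then show ?thesis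
    unfolding rho_def using assms by (intro topology_generated_by_Basis) auto
next
  case False
  then show ?thesis
    unfolding rho_def using assms by (intro topology_generated_by_Basis) auto
qed

lemma openin_rho_agree:
  assumes "I \<noteq> {}" "K \<in> fin_coords I"
  shows "openin (rho I) {y. agree K x y}"
proof -
  have "finite K" "K \<subseteq> I \<times> UNIV"
    using assms by (auto simp: fin_coords_def)
  then show ?thesis
  proof (induction K)
    case empty
    show ?case
      using openin_topspace[of "rho I"] topspace_rho[OF assms(1)] by simp
  next
    case (insert z K)
    obtain \<alpha> p where z: "z = (\<alpha>, p)" by fastforce
    have "{y. agree (insert z K) x y} = {y. x (\<alpha>, p) = y (\<alpha>, p)} \<inter> {y. agree K x y}"
      using z by auto
    then show ?case
      using insert z openin_rho_coordinate[of \<alpha> I x p] by auto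
  qed
qed

text \<open>Induction on the generation of the topology: an intersection joins two finite coordinate
  sets, a union keeps one of them.\<close>

lemma openin_rho_nbhd:
  assumes "openin (rho I) U" "x \<in> U"
  shows "\<exists>K\<in>fin_coords I. {y. agree K x y} \<subseteq> U"
proof -
  have "generate_topology_on
     ({{\<theta>. \<theta> (\<alpha>, p)} | \<alpha> p. \<alpha> \<in> I} \<union> {{\<theta>. \<not> \<theta> (\<alpha>, p)} | \<alpha> p. \<alpha> \<in> I}) U"
    using assms(1) unfolding rho_def openin_topology_generated_by_iff .
  then show ?thesis
    using assms(2)
  proof (induction arbitrary: x)
    case Empty
    then show ?case by simp
  next
    case (Int U V)
    then obtain K L where "K \<in> fin_coords I" "{y. agree K x y} \<subseteq> U"
      "L \<in> fin_coords I" "{y. agree L x y} \<subseteq> V"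
      by (meson IntD1 IntD2)
    then show ?case
      by (intro bexI[of _ "K \<union> L"]) auto
  next
    case (UN \<U>)
    then show ?case by (meson Union_iff Union_upper order_trans)
  next
    case (Basis U)
    then consider \<alpha> p where "\<alpha> \<in> I" "U = {\<theta>. \<theta> (\<alpha>, p)}"
      | \<alpha> p where "\<alpha> \<in> I" "U = {\<theta>. \<not> \<theta> (\<alpha>, p)}"
      by blast
    then show ?case
    proof cases
      case 1
      then show ?thesis using Basis.prems by (intro bexI[of _ "{(\<alpha>, p)}"]) auto
    next
      case 2
      then show ?thesis using Basis.prems by (intro bexI[of _ "{(\<alpha>, p)}"]) auto
    qed
  qed
qed

lemma topspace_subtopology_rho: "I \<noteq> {} \<Longrightarrow> topspace (subtopology (rho I) Z) = Z"
  by (simp add: topspace_rho)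

lemma openin_subtopology_rho:
  assumes "I \<noteq> {}"
  shows "openin (subtopology (rho I) Z) U \<longleftrightarrow>
    U \<subseteq> Z \<and> (\<forall>x\<in>U. \<exists>K\<in>fin_coords I. \<forall>y\<in>Z. agree K x y \<longrightarrow> y \<in> U)"
proof
  assume "openin (subtopology (rho I) Z) U"
  then obtain T where T: "openin (rho I) T" "U = T \<inter> Z"
    by (auto simp: openin_subtopology)
  then show "U \<subseteq> Z \<and> (\<forall>x\<in>U. \<exists>K\<in>fin_coords I. \<forall>y\<in>Z. agree K x y \<longrightarrow> y \<in> U)"
    using openin_rho_nbhd[OF T(1)] by blast
next
  assume U: "U \<subseteq> Z \<and> (\<forall>x\<in>U. \<exists>K\<in>fin_coords I. \<forall>y\<in>Z. agree K x y \<longrightarrow> y \<in> U)"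
  have "\<exists>T. openin (subtopology (rho I) Z) T \<and> x \<in> T \<and> T \<subseteq> U" if "x \<in> U" for x
  proof -
    have "\<exists>K\<in>fin_coords I. \<forall>y\<in>Z. agree K x y \<longrightarrow> y \<in> U"
      using U that by simp
    then obtain K where K: "K \<in> fin_coords I" "\<forall>y\<in>Z. agree K x y \<longrightarrow> y \<in> U"
      by (elim bexE)
    have "openin (subtopology (rho I) Z) (Z \<inter> {y. agree K x y})"
      using openin_rho_agree[OF assms K(1)] by (rule openin_subtopology_Int2)
    then show ?thesis
      using K U that by (intro exI[of _ "Z \<inter> {y. agree K x y}"]) auto
  qed
  then show "openin (subtopology (rho I) Z) U"
    using openin_subopen[of "subtopology (rho I) Z" U] by simp
qed

lemma openin_subtopology_rho_agree:
  assumes "I \<noteq> {}" "K \<in> fin_coords I"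
  shows "openin (subtopology (rho I) Z) {y \<in> Z. agree K x y}"
proof -
  have "{y \<in> Z. agree K x y} = Z \<inter> {y. agree K x y}" by auto
  then show ?thesis
    using openin_subtopology_Int2[OF openin_rho_agree[OF assms]] by simp
qed

text \<open>The complement of the closure of \<open>S\<close> is dense: the neighbourhood of
  \<open>x\<close> given by \<open>K\<close> contains some \<open>y\<close> having a neighbourhood,
  given by \<open>L\<close>, that misses \<open>S\<close>.\<close>

lemma nowhere_dense_in_subtopology_rho:
  assumes "I \<noteq> {}"
  shows "nowhere_dense_in (subtopology (rho I) Z) S \<longleftrightarrow> S \<subseteq> Z \<and>
    (\<forall>x\<in>Z. \<forall>K\<in>fin_coords I. \<exists>y\<in>Z. \<exists>L\<in>fin_coords I. agree K x y \<and> (\<forall>s\<in>S. \<not> agree L y s))"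
proof -
  let ?T = "subtopology (rho I) Z"
  have cl: "y \<in> ?T closure_of S \<longleftrightarrow> y \<in> Z \<and> (\<forall>L\<in>fin_coords I. \<exists>s\<in>S. agree L y s)"
    if "S \<subseteq> Z" for y
  proof -
    have nbhd: "\<exists>s\<in>S. s \<in> T"
      if T: "openin ?T T" "y \<in> T" and dense: "\<forall>L\<in>fin_coords I. \<exists>s\<in>S. agree L y s" for T
    proof -
      obtain L where L: "L \<in> fin_coords I" "\<forall>z\<in>Z. agree L y z \<longrightarrow> z \<in> T"
        using T unfolding openin_subtopology_rho[OF assms] by blast
      obtain s where "s \<in> S" "agree L y s" using dense L(1) by blast
      then show ?thesis using L(2) \<open>S \<subseteq> Z\<close> by blast
    qed
    have coords: "\<exists>s\<in>S. agree L y s" if L: "L \<in> fin_coords I" and y: "y \<in> ?T closure_of S" for L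
    proof -
      have "y \<in> {z \<in> Z. agree L y z}"
        using y closure_of_subset_topspace[of ?T S] topspace_subtopology_rho[OF assms] by auto
      then have "\<exists>s. s \<in> S \<and> s \<in> {z \<in> Z. agree L y z}"
        using y openin_subtopology_rho_agree[OF assms L, of Z y] unfolding in_closure_of by meson
      then show ?thesis by auto
    qed
    show ?thesis
    proof
      assume "y \<in> ?T closure_of S"
      then show "y \<in> Z \<and> (\<forall>L\<in>fin_coords I. \<exists>s\<in>S. agree L y s)"
        using coords by (simp add: in_closure_of)
    next
      assume "y \<in> Z \<and> (\<forall>L\<in>fin_coords I. \<exists>s\<in>S. agree L y s)"
      then show "y \<in> ?T closure_of S"
        unfolding in_closure_of topspace_subtopology_rho[OF assms] using nbhd by auto
    qed
  qed
  have int: "?T interior_of C = {} \<longleftrightarrow> (\<forall>x\<in>Z. \<forall>K\<in>fin_coords I. \<exists>y\<in>Z. agree K x y \<and> y \<notin> C)" for C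
  proof -
    have "\<exists>y\<in>Z. agree K x y \<and> y \<notin> C" if "?T interior_of C = {}" "x \<in> Z" "K \<in> fin_coords I" for x K
    proof (rule ccontr)
      assume "\<not> ?thesis"
      then have "{y \<in> Z. agree K x y} \<subseteq> ?T interior_of C"
        by (intro interior_of_maximal openin_subtopology_rho_agree assms that) auto
      then show False using that by auto
    qed
    moreover have "x \<notin> ?T interior_of C"
      if C: "\<forall>x\<in>Z. \<forall>K\<in>fin_coords I. \<exists>y\<in>Z. agree K x y \<and> y \<notin> C" for x
    proof
      assume "x \<in> ?T interior_of C"
      then obtain T where T: "openin ?T T" "x \<in> T" "T \<subseteq> C"
        by (auto simp: interior_of_def)
      then obtain K where "x \<in> Z" "K \<in> fin_coords I" "\<forall>y\<in>Z. agree K x y \<longrightarrow> y \<in> T"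
        unfolding openin_subtopology_rho[OF assms] by blast
      then show False using C T(3) by blast
    qed
    ultimately show ?thesis by blast
  qed
  show ?thesis
  proof (cases "S \<subseteq> Z")
    case True
    show ?thesis
      unfolding nowhere_dense_in_def topspace_subtopology_rho[OF assms] int cl[OF True]
      using True by blast
  next
    case False
    then show ?thesis
      by (simp add: nowhere_dense_in_def topspace_subtopology_rho[OF assms])
  qed
qed

text \<open>Finitely many sequences are told apart by their prefixes of a common length
  \<open>N\<close>. The cylinders over those prefixes, taken at the points of \<open>K\<close> where
  \<open>g\<close> holds, form the required member of \<open>XX\<close>.\<close>

lemma XX_dense:
  assumes "finite K"
  shows "\<exists>x\<in>XX. agree K g x"
proof -
  \<comment> \<open>A position where two distinct sequences differ; for equal ones it is an
    arbitrary value that the bound \<open>N\<close> covers as well.\<close>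
  define d :: "cantor \<Rightarrow> cantor \<Rightarrow> nat" where "d \<alpha> \<beta> = (SOME i. \<alpha> i \<noteq> \<beta> i)" for \<alpha> \<beta>
  have d: "\<alpha> (d \<alpha> \<beta>) \<noteq> \<beta> (d \<alpha> \<beta>)" if "\<alpha> \<noteq> \<beta>" for \<alpha> \<beta>
    unfolding d_def using that someI_ex[of "\<lambda>i. \<alpha> i \<noteq> \<beta> i"] by (auto simp: fun_eq_iff)
  have "finite ((\<lambda>(z, w). d (fst z) (fst w)) ` (K \<times> K))"
    using assms by simp
  then obtain N where N: "\<forall>i\<in>(\<lambda>(z, w). d (fst z) (fst w)) ` (K \<times> K). i < N"
    unfolding finite_nat_set_iff_bounded by (elim exE)
  define P where "P = (\<lambda>(\<alpha>, p). (map \<alpha> [0..<N], p)) ` {z \<in> K. g z}"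
  have sep: "\<alpha> = \<beta>" if "(\<alpha>, p) \<in> K" "(\<beta>, q) \<in> K" "\<forall>i<N. \<beta> i = \<alpha> i" for \<alpha> \<beta> p q
  proof -
    have "(\<lambda>(z, w). d (fst z) (fst w)) ((\<alpha>, p), (\<beta>, q)) < N"
      using N that(1,2) by (intro bspec[OF N] imageI) simp
    then have "\<beta> (d \<alpha> \<beta>) = \<alpha> (d \<alpha> \<beta>)" using that(3) by simp
    then show ?thesis using d[of \<alpha> \<beta>] by metis
  qed
  have "(z \<in> (\<Union>(s, n)\<in>P. cyl s \<times> {n})) = g z" if "z \<in> K" for z
  proof -
    obtain \<beta> q where z: "z = (\<beta>, q)" by fastforce
    have "z \<in> (\<Union>(s, n)\<in>P. cyl s \<times> {n}) \<longleftrightarrow> (\<exists>\<alpha>. (\<alpha>, q) \<in> K \<and> g (\<alpha>, q) \<and> (\<forall>i<N. \<beta> i = \<alpha> i))"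
      unfolding z P_def cyl_def by force
    then show ?thesis
      using sep that z by blast
  qed
  then have "agree K g (\<lambda>z. z \<in> (\<Union>(s, n)\<in>P. cyl s \<times> {n}))"
    by (simp add: agree_def)
  moreover have "finite P" using assms by (simp add: P_def)
  then have "(\<lambda>z. z \<in> (\<Union>(s, n)\<in>P. cyl s \<times> {n})) \<in> XX"
    unfolding XX_def by blast
  ultimately show ?thesis by (rule bexI)
qed

text \<open>Only finitely many second components occur in a finite union. Beyond them
  \<open>psi \<phi> n\<close> shows just bit \<open>n\<close> of the sequence.\<close>

lemma XX_bounded_support:
  assumes "x \<in> XX"
  shows "\<exists>N. \<forall>q\<ge>N. \<forall>\<alpha>. \<not> x (\<alpha>, q)"
proof -
  obtain P where P: "finite P" "x = (\<lambda>z. z \<in> (\<Union>(s, n)\<in>P. cyl s \<times> {n}))"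
    using assms by (auto simp: XX_def)
  then obtain N where N: "\<forall>i\<in>snd ` P. i < N"
    using finite_nat_set_iff_bounded finite_imageI by metis
  then show ?thesis
    unfolding P(2) by (intro exI[of _ N]) force
qed

section \<open>Boxes of coordinates along a sequence\<close>

definition box :: "(nat \<Rightarrow> cantor) \<Rightarrow> nat \<Rightarrow> (cantor \<times> nat) set" where
  "box \<alpha> N = \<alpha> ` {..<N} \<times> {..<N}"

lemma agree_box: "agree (box \<alpha> N) x y \<longleftrightarrow> (\<forall>i<N. \<forall>p<N. x (\<alpha> i, p) = y (\<alpha> i, p))"
  by (auto simp: agree_def box_def)

lemma agree_mono: "K \<subseteq> L \<Longrightarrow> agree L x y \<Longrightarrow> agree K x y"
  by (auto simp: agree_def)

lemma box_mono: "M \<le> N \<Longrightarrow> box \<alpha> M \<subseteq> box \<alpha> N"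
  by (force simp: box_def)

lemma box_in_fin_coords: "range \<alpha> \<subseteq> I \<Longrightarrow> box \<alpha> N \<in> fin_coords I"
  by (auto simp: box_def fin_coords_def)

text \<open>Boxes along \<open>\<alpha>\<close> are cofinal among the finite coordinate sets over
  its range, so a quantifier over such sets turns into one over natural numbers.\<close>

lemma fin_coords_subset_box:
  assumes "K \<in> fin_coords (range \<alpha>)"
  shows "\<exists>N. K \<subseteq> box \<alpha> N"
proof -
  have "finite K" "K \<subseteq> range \<alpha> \<times> UNIV"
    using assms by (auto simp: fin_coords_def)
  then show ?thesis
  proof (induction K)
    case (insert z K)
    then obtain N where N: "K \<subseteq> box \<alpha> N" by auto
    obtain i p where z: "z = (\<alpha> i, p)" using insert.prems by auto
    have "z \<in> box \<alpha> (N + Suc i + Suc p)" unfolding z box_def by auto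
    moreover have "K \<subseteq> box \<alpha> (N + Suc i + Suc p)"
      using N box_mono[of N "N + Suc i + Suc p" \<alpha>] by auto
    ultimately show ?case by blast
  qed simp
qed

text \<open>Membership in finitely many cylinders is decided by a finite prefix. This makes
  agreement on a box clopen in the sequence that spans the box.\<close>

lemma XX_continuous:
  assumes "x \<in> XX"
  shows "continuous_on UNIV (\<lambda>\<beta>. x (\<beta>, p))"
proof (rule continuous_on_seq_locally_constant)
  fix \<beta> :: cantor
  obtain P where P: "finite P" "x = (\<lambda>z. z \<in> (\<Union>(s, n)\<in>P. cyl s \<times> {n}))"
    using assms by (auto simp: XX_def)
  have "finite (length ` fst ` P)" using P(1) by simp
  then obtain N where N: "\<forall>l\<in>length ` fst ` P. l < N"
    unfolding finite_nat_set_iff_bounded by (elim exE)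
  have "x (\<gamma>, p) = x (\<beta>, p)" if "\<forall>i<N. \<gamma> i = \<beta> i" for \<gamma>
  proof -
    have "\<gamma> \<in> cyl s \<longleftrightarrow> \<beta> \<in> cyl s" if "(s, n) \<in> P" for s n
    proof -
      have "length s < N" using N that by force
      then show ?thesis using \<open>\<forall>i<N. \<gamma> i = \<beta> i\<close> by (auto simp: cyl_def)
    qed
    then show ?thesis unfolding P(2) by auto
  qed
  then show "\<exists>N. \<forall>\<gamma>. (\<forall>i<N. \<gamma> i = \<beta> i) \<longrightarrow> x (\<gamma>, p) = x (\<beta>, p)" by blast
qed

lemma continuous_on_agree_box:
  fixes x y :: point
  assumes "\<And>i p. continuous_on UNIV (\<lambda>z. x (\<alpha> z i, p))" "\<And>i p. continuous_on UNIV (\<lambda>z. y (\<alpha> z i, p))"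
  shows "continuous_on UNIV (\<lambda>z. agree (box (\<alpha> z) N) x y)"
  unfolding agree_box
  by (intro continuous_on_all_less continuous_on_eq_discrete assms)

section \<open>The ideals \<open>\<I>\<^sup>k\<close> and the spaces \<open>\<Y>(\<I>\<^sup>k)\<close>\<close>

locale enumeration =
  fixes \<phi> :: "nat \<Rightarrow> point"
  assumes enum: "enumerates_XX \<phi>"
begin

lemma range_phi: "range \<phi> = XX"
  using enum by (auto simp: enumerates_XX_def bij_betw_def)

lemma phi_dense: "finite K \<Longrightarrow> \<exists>n. agree K g (\<phi> n)"
  using XX_dense[of K g] unfolding range_phi[symmetric] by blast

lemma phi_bounded_support: "\<exists>N. \<forall>q\<ge>N. \<forall>\<alpha>. \<not> \<phi> n (\<alpha>, q)"
  using XX_bounded_support[of "\<phi> n"] range_phi by auto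

lemma psi_eq: "psi \<phi> n z = (fst z n \<or> \<phi> n z)"
  by (cases z) (simp add: psi_def)

text \<open>Far beyond both supports \<open>psi \<phi> n\<close> evaluates to bit \<open>n\<close>
  of the sequence, so the characteristic function of \<open>n\<close> alone recovers the
  index.\<close>

lemma inj_psi: "inj (psi \<phi>)"
proof (rule injI)
  fix n m assume eq: "psi \<phi> n = psi \<phi> m"
  obtain M N where "\<forall>q\<ge>M. \<forall>\<alpha>. \<not> \<phi> n (\<alpha>, q)" "\<forall>q\<ge>N. \<forall>\<alpha>. \<not> \<phi> m (\<alpha>, q)"
    using phi_bounded_support by blast
  then have "\<not> \<phi> n (\<alpha>, M + N)" "\<not> \<phi> m (\<alpha>, M + N)" for \<alpha>
    by simp_all
  then have psi: "psi \<phi> n (\<alpha>, M + N) = \<alpha> n" "psi \<phi> m (\<alpha>, M + N) = \<alpha> m" for \<alpha>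
    by (simp_all add: psi_eq)
  show "n = m"
    using psi(1)[of "\<lambda>i. i = n"] psi(2)[of "\<lambda>i. i = n"] unfolding eq by auto
qed

section \<open>Nowhere dense index sets\<close>

lemma star_iff:
  assumes "I \<noteq> {}"
  shows "F \<in> star \<phi> I \<longleftrightarrow> (\<forall>n. \<forall>K\<in>fin_coords I. \<exists>n'. \<exists>L\<in>fin_coords I.
    agree K (\<phi> n) (\<phi> n') \<and> (\<forall>m. F m \<longrightarrow> \<not> agree L (\<phi> n') (\<phi> m)))"
  unfolding star_def X_space_def mem_Collect_eq nowhere_dense_in_subtopology_rho[OF assms]
    range_phi[symmetric]
  by (simp add: setcompr_eq_image image_mono)

text \<open>By density, some \<open>\<phi> n\<close> copies any point on finitely many coordinates.
  Witnesses can therefore be glued coordinate by coordinate, although the result may lie outside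
  \<open>XX\<close>.\<close>

lemma star_iff_points:
  assumes "I \<noteq> {}"
  shows "F \<in> star \<phi> I \<longleftrightarrow> (\<forall>g. \<forall>K\<in>fin_coords I. \<exists>h. \<exists>L\<in>fin_coords I.
    agree K g h \<and> (\<forall>m. F m \<longrightarrow> \<not> agree L h (\<phi> m)))" (is "_ \<longleftrightarrow> ?R")
proof -
  show ?thesis
  proof
    assume F: "F \<in> star \<phi> I"
    show ?R
    proof (intro allI ballI)
      fix g K assume K: "K \<in> fin_coords I"
      obtain n where n: "agree K g (\<phi> n)"
        using phi_dense[OF fin_coords_finite[OF K], of g] by (elim exE)
      obtain n' L where "L \<in> fin_coords I" "agree K (\<phi> n) (\<phi> n')" "\<forall>m. F m \<longrightarrow> \<not> agree L (\<phi> n') (\<phi> m)"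
        using F K unfolding star_iff[OF assms] by blast
      with n show "\<exists>h. \<exists>L\<in>fin_coords I. agree K g h \<and> (\<forall>m. F m \<longrightarrow> \<not> agree L h (\<phi> m))"
        by (meson agree_trans)
    qed
  next
    assume R: ?R
    show "F \<in> star \<phi> I"
      unfolding star_iff[OF assms]
    proof (intro allI ballI)
      fix n K assume K: "K \<in> fin_coords I"
      then obtain h L where L: "L \<in> fin_coords I" "agree K (\<phi> n) h" "\<forall>m. F m \<longrightarrow> \<not> agree L h (\<phi> m)"
        using R by meson
      obtain n' where "agree (K \<union> L) h (\<phi> n')"
        using phi_dense[of "K \<union> L" h] fin_coords_finite[of "K \<union> L" I] K L(1) by auto
      then have "agree K h (\<phi> n')" "agree L h (\<phi> n')" by simp_all
      with L show "\<exists>n'. \<exists>L\<in>fin_coords I. agree K (\<phi> n) (\<phi> n') \<and> (\<forall>m. F m \<longrightarrow> \<not> agree L (\<phi> n') (\<phi> m))"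
        by (meson agree_trans)
    qed
  qed
qed

lemma starD:
  assumes "F \<in> star \<phi> I" "I \<noteq> {}" "K \<in> fin_coords I"
  obtains h L where "L \<in> fin_coords I" "agree K g h" "\<forall>m. F m \<longrightarrow> \<not> agree L h (\<phi> m)"
proof -
  have "\<exists>h. \<exists>L\<in>fin_coords I. agree K g h \<and> (\<forall>m. F m \<longrightarrow> \<not> agree L h (\<phi> m))"
    using assms(1,3) unfolding star_iff_points[OF assms(2)] by blast
  then show ?thesis using that by blast
qed

text \<open>Avoiding \<open>F\<close> takes coordinates over \<open>J\<close> only; the coordinates
  of \<open>K\<close> outside \<open>J\<close> can be kept as they are.\<close>

lemma star_mono:
  assumes "J \<subseteq> I" "J \<noteq> {}"
  shows "star \<phi> J \<subseteq> star \<phi> I"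
proof
  fix F assume F: "F \<in> star \<phi> J"
  have "I \<noteq> {}" using assms by auto
  show "F \<in> star \<phi> I"
    unfolding star_iff_points[OF \<open>I \<noteq> {}\<close>]
  proof (intro allI ballI)
    fix g K assume K: "K \<in> fin_coords I"
    obtain h L where L: "L \<in> fin_coords J" "agree (K \<inter> J \<times> UNIV) g h" "\<forall>m. F m \<longrightarrow> \<not> agree L h (\<phi> m)"
      using starD[OF F assms(2) fin_coords_restrict[OF K]] .
    \<comment> \<open>The glued point takes the witness over \<open>J\<close> and \<open>g\<close>
      elsewhere, so it agrees with \<open>g\<close> on all of \<open>K\<close> and with
      \<open>h\<close> on \<open>L\<close>.\<close>
    define h' where "h' z = (if fst z \<in> J then h z else g z)" for z
    have "agree K g h'"
      using L(2) by (auto simp: h'_def agree_def)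
    moreover have "agree L h h'"
      using fin_coords_fst[OF L(1)] by (simp add: h'_def agree_def)
    ultimately show "\<exists>h. \<exists>L\<in>fin_coords I. agree K g h \<and> (\<forall>m. F m \<longrightarrow> \<not> agree L h (\<phi> m))"
      using L(3) fin_coords_mono[OF assms(1) L(1)] agree_trans by blast
  qed
qed

lemma star_empty: "I \<noteq> {} \<Longrightarrow> (\<lambda>_. False) \<in> star \<phi> I"
  unfolding star_iff_points by (meson agree_refl fin_coords_empty)

text \<open>First \<open>F\<close> is avoided, then \<open>G\<close> inside the smaller
  neighbourhood given by \<open>K \<union> L1\<close>, where \<open>F\<close> stays avoided.\<close>

lemma star_disj:
  assumes "I \<noteq> {}" "F \<in> star \<phi> I" "G \<in> star \<phi> I"
  shows "(\<lambda>n. F n \<or> G n) \<in> star \<phi> I"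
  unfolding star_iff_points[OF assms(1)]
proof (intro allI ballI)
  fix g K assume K: "K \<in> fin_coords I"
  obtain h1 L1 where 1: "L1 \<in> fin_coords I" "agree K g h1" "\<forall>m. F m \<longrightarrow> \<not> agree L1 h1 (\<phi> m)"
    using starD[OF assms(2,1) K] .
  have KL: "K \<union> L1 \<in> fin_coords I" using K 1(1) by simp
  obtain h2 L2 where 2: "L2 \<in> fin_coords I" "agree (K \<union> L1) h1 h2" "\<forall>m. G m \<longrightarrow> \<not> agree L2 h2 (\<phi> m)"
    using starD[OF assms(3,1) KL] .
  show "\<exists>h. \<exists>L\<in>fin_coords I. agree K g h \<and> (\<forall>m. F m \<or> G m \<longrightarrow> \<not> agree L h (\<phi> m))"
    using 1 2 agree_trans[of K g h1 h2] agree_trans[of L1 h1 h2]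
    by (intro exI[of _ h2] bexI[of _ "L1 \<union> L2"]) auto
qed

lemma star_singleton:
  assumes "I \<noteq> {}"
  shows "(\<lambda>i. i = n) \<in> star \<phi> I"
  unfolding star_iff_points[OF assms]
proof (intro allI ballI)
  fix g K assume K: "K \<in> fin_coords I"
  obtain \<alpha> where \<alpha>: "\<alpha> \<in> I" using assms by blast
  \<comment> \<open>A level that \<open>K\<close> does not touch leaves room to disagree with
    \<open>\<phi> n\<close> while still agreeing with \<open>g\<close> on \<open>K\<close>.\<close>
  obtain p where p: "p \<notin> snd ` K"
    using fin_coords_finite[OF K] by (metis ex_new_if_finite finite_imageI infinite_UNIV_nat)
  have "agree K g (g((\<alpha>, p) := \<not> \<phi> n (\<alpha>, p)))" using p by (force simp: agree_def)
  then show "\<exists>h. \<exists>L\<in>fin_coords I. agree K g h \<and> (\<forall>m. m = n \<longrightarrow> \<not> agree L h (\<phi> m))"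
    using \<alpha> by (intro exI[of _ "g((\<alpha>, p) := \<not> \<phi> n (\<alpha>, p))"] bexI[of _ "{(\<alpha>, p)}"]) auto
qed

lemma iter_star_nonempty: "iter_star \<phi> k \<noteq> {}"
proof (induction k)
  case (Suc k)
  then show ?case using star_empty[OF Suc] by auto
qed simp

text \<open>The start lies in \<open>UNIV\<close>; monotonicity carries each inclusion one step
  further.\<close>

lemma iter_star_Suc_subset: "iter_star \<phi> (Suc k) \<subseteq> iter_star \<phi> k"
proof (induction k)
  case (Suc k)
  then show ?case
    using star_mono[OF Suc iter_star_nonempty] by simp
qed simp

text \<open>These are the indices that \<open>K\<close> may distort: off this set
  \<open>\<phi> n\<close> and \<open>psi \<phi> n\<close> agree on \<open>K\<close>.\<close>

lemma star_bex:
  assumes "I \<noteq> {}" "K \<in> fin_coords (star \<phi> I)"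
  shows "(\<lambda>n. \<exists>z\<in>K. fst z n) \<in> star \<phi> I"
proof -
  have "finite K" "\<forall>z\<in>K. fst z \<in> star \<phi> I"
    using assms(2) by (auto simp: fin_coords_def)
  then show ?thesis
  proof (induction K)
    case empty
    then show ?case using star_empty[OF assms(1)] by simp
  next
    case (insert z K)
    then show ?case using star_disj[OF assms(1), of "fst z"] by simp
  qed
qed

section \<open>Crowdedness and closed nowhere dense sets\<close>

lemma agree_phi_psi: "\<forall>z\<in>K. \<not> fst z n \<Longrightarrow> agree K (\<phi> n) (psi \<phi> n)"
  by (simp add: psi_eq agree_def)

text \<open>\<open>F\<close> together with the indices distorted on \<open>K\<close> is still
  nowhere dense, so the neighbourhood of \<open>g\<close> contains a smaller one free of them. Any
  \<open>\<phi> n\<close> found there equals \<open>psi \<phi> n\<close> on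
  \<open>K\<close>.\<close>

lemma psi_dense_off_star:
  assumes "I \<noteq> {}" "star \<phi> I \<subseteq> I" "F \<in> star \<phi> I" "K \<in> fin_coords (star \<phi> I)"
  shows "\<exists>n. \<not> F n \<and> agree K g (psi \<phi> n)"
proof -
  let ?D = "\<lambda>n. F n \<or> (\<exists>z\<in>K. fst z n)"
  have D: "?D \<in> star \<phi> I"
    using assms star_disj star_bex by blast
  have K: "K \<in> fin_coords I"
    using fin_coords_mono assms(2,4) by blast
  obtain h L where L: "L \<in> fin_coords I" "agree K g h" "\<forall>m. ?D m \<longrightarrow> \<not> agree L h (\<phi> m)"
    using starD[OF D assms(1) K] .
  obtain n where n: "agree (K \<union> L) h (\<phi> n)"
    using phi_dense[of "K \<union> L" h] fin_coords_finite[of "K \<union> L" I] K L(1) by auto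
  then have nD: "\<not> ?D n" using L(3) by auto
  then have "agree K (\<phi> n) (psi \<phi> n)" using agree_phi_psi by blast
  moreover have "agree K h (\<phi> n)" using n by simp
  ultimately have "agree K g (psi \<phi> n)" using L(2) by (meson agree_trans)
  then show ?thesis using nD by blast
qed

text \<open>Density off the one-element set of \<open>n\<close> puts a second index, hence by
  injectivity a second point, into every neighbourhood of \<open>psi \<phi> n\<close>.\<close>

lemma Y_space_crowded:
  assumes "I \<noteq> {}" "star \<phi> I \<subseteq> I"
  shows "crowded_space (Y_space \<phi> (star \<phi> I))"
proof -
  have ne: "star \<phi> I \<noteq> {}" using star_empty[OF assms(1)] by auto
  have "\<not> openin (Y_space \<phi> (star \<phi> I)) {psi \<phi> n}" for n
  proof
    assume "openin (Y_space \<phi> (star \<phi> I)) {psi \<phi> n}"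
    then have "\<exists>K\<in>fin_coords (star \<phi> I). \<forall>m. agree K (psi \<phi> n) (psi \<phi> m) \<longrightarrow> psi \<phi> m = psi \<phi> n"
      unfolding Y_space_def openin_subtopology_rho[OF ne] YY_def by simp
    then obtain K where K: "K \<in> fin_coords (star \<phi> I)"
      "\<forall>m. agree K (psi \<phi> n) (psi \<phi> m) \<longrightarrow> psi \<phi> m = psi \<phi> n"
      by (elim bexE)
    obtain m where "m \<noteq> n" "agree K (psi \<phi> n) (psi \<phi> m)"
      using psi_dense_off_star[OF assms star_singleton[OF assms(1), of n] K(1), of "psi \<phi> n"] by blast
    then show False
      using K(2) inj_psi by (auto dest: injD)
  qed
  then show ?thesis
    unfolding crowded_space_def Y_space_def topspace_subtopology_rho[OF ne] by (simp add: YY_def)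
qed

text \<open>A neighbourhood missing \<open>S\<close> is found in the space of the
  \<open>psi \<phi> n\<close>. Shrinking it once more to exclude the indices distorted on its
  coordinates \<open>L\<close> turns avoidance of \<open>psi \<phi> m\<close> into avoidance of
  \<open>\<phi> m\<close>.\<close>

lemma star_if_nowhere_dense_Y:
  assumes "I \<noteq> {}" "star \<phi> I \<subseteq> I"
    and nd: "nowhere_dense_in (Y_space \<phi> (star \<phi> I)) S"
  shows "(\<lambda>n. psi \<phi> n \<in> S) \<in> star \<phi> I"
  unfolding star_iff_points[OF assms(1)]
proof (intro allI ballI)
  let ?J = "star \<phi> I"
  have ne: "?J \<noteq> {}" using star_empty[OF assms(1)] by auto
  fix g K assume K: "K \<in> fin_coords I"
  \<comment> \<open>Only the coordinates of \<open>K\<close> over \<open>star \<phi> I\<close> are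
    available in \<open>Y_space\<close>; the others are restored by \<open>h\<close> below, which
    keeps \<open>g\<close> there.\<close>
  have K0: "K \<inter> ?J \<times> UNIV \<in> fin_coords ?J" (is "?K0 \<in> _")
    using fin_coords_restrict[OF K] .
  obtain n where n: "agree ?K0 g (psi \<phi> n)"
    using psi_dense_off_star[OF assms(1,2) star_empty[OF assms(1)] K0] by blast
  obtain n' L where L: "L \<in> fin_coords ?J" "agree ?K0 (psi \<phi> n) (psi \<phi> n')"
    "\<forall>s\<in>S. \<not> agree L (psi \<phi> n') s"
    using nd K0 unfolding Y_space_def nowhere_dense_in_subtopology_rho[OF ne] YY_def by blast
  define h where "h z = (if fst z \<in> ?J then psi \<phi> n' z else g z)" for z
  have gh: "agree K g h"
    using agree_trans[OF n L(2)] by (auto simp: h_def agree_def)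
  have hL: "agree L (psi \<phi> n') h"
    using fin_coords_fst[OF L(1)] by (simp add: h_def agree_def)
  have LI: "L \<in> fin_coords I"
    using fin_coords_mono[OF assms(2) L(1)] .
  then have KL: "K \<union> L \<in> fin_coords I" using K by simp
  \<comment> \<open>The indices distorted on \<open>L\<close> form a member of
    \<open>star \<phi> I\<close>, so they can be avoided while agreement on
    \<open>K \<union> L\<close> is preserved.\<close>
  obtain h' L' where L': "L' \<in> fin_coords I" "agree (K \<union> L) h h'"
    "\<forall>m. (\<exists>z\<in>L. fst z m) \<longrightarrow> \<not> agree L' h' (\<phi> m)"
    using starD[OF star_bex[OF assms(1) L(1)] assms(1) KL] .
  have "\<not> agree (L \<union> L') h' (\<phi> m)" if "psi \<phi> m \<in> S" for m
  proof
    assume a: "agree (L \<union> L') h' (\<phi> m)"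
    then have "\<forall>z\<in>L. \<not> fst z m" using L'(3) by auto
    then have "agree L (\<phi> m) (psi \<phi> m)" using agree_phi_psi by blast
    moreover have "agree L h h'" "agree L h' (\<phi> m)" using L'(2) a by simp_all
    ultimately have "agree L (psi \<phi> n') (psi \<phi> m)"
      using hL by (meson agree_trans)
    then show False using L(3) that by blast
  qed
  moreover have "agree K g h'" using gh L'(2) agree_trans[of K g h h'] by simp
  ultimately show "\<exists>h. \<exists>L\<in>fin_coords I. agree K g h \<and> (\<forall>m. psi \<phi> m \<in> S \<longrightarrow> \<not> agree L h (\<phi> m))"
    using LI L'(1) by (intro exI[of _ h'] bexI[of _ "L \<union> L'"]) auto
qed

text \<open>The index set of \<open>S\<close> serves as a coordinate: every
  \<open>psi \<phi> m\<close> in \<open>S\<close> is true there at all levels, while a point outside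
  \<open>S\<close> is false at a level beyond the support of its \<open>\<phi> n\<close>.\<close>

lemma closedin_Y_space:
  assumes "(\<lambda>n. psi \<phi> n \<in> S) \<in> J" "S \<subseteq> YY \<phi>"
  shows "closedin (Y_space \<phi> J) S"
proof -
  let ?A = "\<lambda>n. psi \<phi> n \<in> S"
  have ne: "J \<noteq> {}" using assms(1) by blast
  have "\<exists>K\<in>fin_coords J. \<forall>y\<in>YY \<phi>. agree K x y \<longrightarrow> y \<in> YY \<phi> - S" if x: "x \<in> YY \<phi> - S" for x
  proof -
    obtain n where n: "x = psi \<phi> n" using x by (auto simp: YY_def)
    obtain p where "\<not> \<phi> n (?A, p)" using phi_bounded_support[of n] by blast
    then have "\<forall>y\<in>YY \<phi>. agree {(?A, p)} x y \<longrightarrow> y \<in> YY \<phi> - S"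
      using x by (auto simp: psi_eq n YY_def)
    then show ?thesis
      using assms(1) by (intro bexI[of _ "{(?A, p)}"]) simp_all
  qed
  then show ?thesis
    unfolding closedin_def Y_space_def topspace_subtopology_rho[OF ne] openin_subtopology_rho[OF ne]
    using assms(2) by simp
qed

lemma Y_space_nodec:
  assumes "I \<noteq> {}" "star \<phi> I \<subseteq> I"
  shows "nodec_space (Y_space \<phi> (star \<phi> I))"
  unfolding nodec_space_def
proof (intro allI impI)
  fix S assume nd: "nowhere_dense_in (Y_space \<phi> (star \<phi> I)) S"
  have "star \<phi> I \<noteq> {}" using star_empty[OF assms(1)] by auto
  then have "S \<subseteq> YY \<phi>"
    using nd by (simp add: nowhere_dense_in_def Y_space_def topspace_rho)
  then show "closedin (Y_space \<phi> (star \<phi> I)) S"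
    using closedin_Y_space star_if_nowhere_dense_Y[OF assms nd] by blast
qed

section \<open>Reduction to countably many coordinates\<close>

lemma star_range_iff:
  "F \<in> star \<phi> (range \<alpha>) \<longleftrightarrow> (\<forall>n N. \<exists>n' N'. agree (box \<alpha> N) (\<phi> n) (\<phi> n') \<and>
    (\<forall>m. F m \<longrightarrow> \<not> agree (box \<alpha> N') (\<phi> n') (\<phi> m)))" (is "_ \<longleftrightarrow> ?R")
proof
  have ne: "range \<alpha> \<noteq> {}" by simp
  assume F: "F \<in> star \<phi> (range \<alpha>)"
  show ?R
  proof (intro allI)
    fix n N
    obtain n' L where L: "L \<in> fin_coords (range \<alpha>)" "agree (box \<alpha> N) (\<phi> n) (\<phi> n')"
      "\<forall>m. F m \<longrightarrow> \<not> agree L (\<phi> n') (\<phi> m)"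
      using F box_in_fin_coords[OF order_refl, of \<alpha> N] unfolding star_iff[OF ne] by blast
    obtain N' where "L \<subseteq> box \<alpha> N'" using fin_coords_subset_box[OF L(1)] by blast
    then show "\<exists>n' N'. agree (box \<alpha> N) (\<phi> n) (\<phi> n') \<and> (\<forall>m. F m \<longrightarrow> \<not> agree (box \<alpha> N') (\<phi> n') (\<phi> m))"
      using L(2,3) agree_mono by meson
  qed
next
  assume R: ?R
  have ne: "range \<alpha> \<noteq> {}" by simp
  show "F \<in> star \<phi> (range \<alpha>)"
    unfolding star_iff[OF ne]
  proof (intro allI ballI)
    fix n K assume "K \<in> fin_coords (range \<alpha>)"
    then obtain N where N: "K \<subseteq> box \<alpha> N" using fin_coords_subset_box by blast
    obtain n' N' where "agree (box \<alpha> N) (\<phi> n) (\<phi> n')" "\<forall>m. F m \<longrightarrow> \<not> agree (box \<alpha> N') (\<phi> n') (\<phi> m)"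
      using R by meson
    then show "\<exists>n'. \<exists>L\<in>fin_coords (range \<alpha>). agree K (\<phi> n) (\<phi> n') \<and> (\<forall>m. F m \<longrightarrow> \<not> agree L (\<phi> n') (\<phi> m))"
      using agree_mono[OF N] box_in_fin_coords[OF order_refl, of \<alpha> N'] by blast
  qed
qed

text \<open>A closing-off argument in the style of Loewenheim-Skolem. It uses the form with indices
  \<open>n\<close> rather than arbitrary points \<open>g\<close>, so that a countable stage raises
  only countably many demands.\<close>

lemma star_countable_subset:
  assumes "I \<noteq> {}" "F \<in> star \<phi> I"
  obtains J where "countable J" "J \<noteq> {}" "J \<subseteq> I" "F \<in> star \<phi> J"
proof -
  obtain \<alpha>\<^sub>0 where \<alpha>\<^sub>0: "\<alpha>\<^sub>0 \<in> I" using assms(1) by blast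
  define W where "W n K L \<longleftrightarrow> L \<in> fin_coords I \<and>
    (\<exists>n'. agree K (\<phi> n) (\<phi> n') \<and> (\<forall>m. F m \<longrightarrow> \<not> agree L (\<phi> n') (\<phi> m)))" for n K L
  define w where "w n K = (SOME L. W n K L)" for n K
  have w: "W n K (w n K)" if "K \<in> fin_coords I" for n K
  proof -
    have "\<exists>L. W n K L"
      using assms(2) that unfolding star_iff[OF assms(1)] W_def by blast
    then show ?thesis unfolding w_def by (rule someI_ex)
  qed
  \<comment> \<open>Each stage adds the sequences occurring in the chosen witnesses for all finite
    coordinate sets over the previous stage.\<close>
  define J where "J = rec_nat {\<alpha>\<^sub>0} (\<lambda>_ A. A \<union> (\<Union>n. \<Union>K\<in>fin_coords A. fst ` w n K))"
  have J0: "J 0 = {\<alpha>\<^sub>0}" and JS: "J (Suc i) = J i \<union> (\<Union>n. \<Union>K\<in>fin_coords (J i). fst ` w n K)" for i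
    by (simp_all add: J_def)
  have sub: "J i \<subseteq> I" for i
  proof (induction i)
    case (Suc i)
    have "fst z \<in> I" if "K \<in> fin_coords (J i)" "z \<in> w n K" for n K z
      using w[OF fin_coords_mono[OF Suc that(1)]] that(2) fin_coords_fst unfolding W_def by blast
    then show ?case using Suc unfolding JS by blast
  qed (simp add: J0 \<alpha>\<^sub>0)
  have count: "countable (J i)" for i
  proof (induction i)
    case (Suc i)
    have "countable {K. finite K \<and> K \<subseteq> J i \<times> (UNIV :: nat set)}"
      using Suc by (intro countable_Collect_finite_subset) auto
    then have "countable (fin_coords (J i))"
      by (simp add: fin_coords_def)
    moreover have "countable (fst ` w n K)" if "K \<in> fin_coords (J i)" for n K
    proof -
      have "finite (w n K)"
        using w[OF fin_coords_mono[OF sub that]] fin_coords_finite unfolding W_def by blast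
      then show ?thesis by (simp add: countable_finite)
    qed
    ultimately show ?case
      using Suc unfolding JS by (intro countable_Un countable_UN) auto
  qed (simp add: J0)
  have mono: "J i \<subseteq> J j" if "i \<le> j" for i j
    using that by (rule lift_Suc_mono_le[of J, rotated]) (simp add: JS)
  have stage: "\<exists>i. K \<in> fin_coords (J i)" if K: "K \<in> fin_coords (\<Union>i. J i)" for K
  proof -
    have "finite K" "K \<subseteq> (\<Union>i. J i) \<times> UNIV"
      using K by (auto simp: fin_coords_def)
    then show ?thesis
    proof (induction K)
      case (insert z K)
      then obtain i where i: "K \<in> fin_coords (J i)" by auto
      obtain j where j: "fst z \<in> J j" using insert.prems by auto
      have "K \<in> fin_coords (J (max i j))" "fst z \<in> J (max i j)"
        using fin_coords_mono[OF mono i, of "max i j"] mono[of j "max i j"] j by auto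
      then show ?case by (intro exI[of _ "max i j"]) simp
    qed simp
  qed
  have ne: "(\<Union>i. J i) \<noteq> {}" using J0 by blast
  have "F \<in> star \<phi> (\<Union>i. J i)"
    unfolding star_iff[OF ne]
  proof (intro allI ballI)
    fix n K assume "K \<in> fin_coords (\<Union>i. J i)"
    then obtain i where i: "K \<in> fin_coords (J i)" using stage by blast
    have W: "W n K (w n K)" using w fin_coords_mono[OF sub i] by blast
    have "fst z \<in> J (Suc i)" if "z \<in> w n K" for z
      using that i unfolding JS by blast
    then have "w n K \<subseteq> (\<Union>i. J i) \<times> UNIV" by fastforce
    then have "w n K \<in> fin_coords (\<Union>i. J i)"
      using W unfolding W_def fin_coords_def by blast
    then show "\<exists>n'. \<exists>L\<in>fin_coords (\<Union>i. J i). agree K (\<phi> n) (\<phi> n') \<and> (\<forall>m. F m \<longrightarrow> \<not> agree L (\<phi> n') (\<phi> m))"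
      using W unfolding W_def by blast
  qed
  moreover have "countable (\<Union>i. J i)" "(\<Union>i. J i) \<subseteq> I"
    using count sub by auto
  ultimately show ?thesis using ne that by blast
qed

text \<open>Countable subsets are replaced by sequences, possibly with repetitions. Now
  \<open>I\<close> enters only through positive membership conditions, as analyticity
  requires.\<close>

lemma star_iff_sequence:
  assumes "I \<noteq> {}"
  shows "F \<in> star \<phi> I \<longleftrightarrow> (\<exists>\<alpha>. (\<forall>j::nat. \<alpha> j \<in> I) \<and> F \<in> star \<phi> (range \<alpha>))"
proof
  assume "F \<in> star \<phi> I"
  then obtain J where J: "countable J" "J \<noteq> {}" "J \<subseteq> I" "F \<in> star \<phi> J"
    by (rule star_countable_subset[OF assms])
  have r: "range (from_nat_into J) = J" by (rule range_from_nat_into[OF J(2,1)])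
  have "from_nat_into J j \<in> I" for j
    using from_nat_into[OF J(2), of j] J(3) by blast
  then show "\<exists>\<alpha>. (\<forall>j::nat. \<alpha> j \<in> I) \<and> F \<in> star \<phi> (range \<alpha>)"
    using J(4) r by (intro exI[of _ "from_nat_into J"]) simp
next
  assume "\<exists>\<alpha>. (\<forall>j::nat. \<alpha> j \<in> I) \<and> F \<in> star \<phi> (range \<alpha>)"
  then obtain \<alpha> :: "nat \<Rightarrow> cantor" where "range \<alpha> \<subseteq> I" "F \<in> star \<phi> (range \<alpha>)" by blast
  then show "F \<in> star \<phi> I" using star_mono[of "range \<alpha>" I] by blast
qed

section \<open>Analyticity of the ideals and of the topology\<close>

lemma continuous_on_fst_coordinate:
  "continuous_on UNIV (\<lambda>z :: cantor \<times> (nat \<Rightarrow> cantor). fst z j)"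
  by (rule continuous_on_product_then_coordinatewise[OF continuous_on_fst[OF continuous_on_id]])

lemma continuous_on_snd_coordinate:
  "continuous_on UNIV (\<lambda>z :: cantor \<times> (nat \<Rightarrow> cantor). snd z j)"
  by (rule continuous_on_product_then_coordinatewise[OF continuous_on_snd[OF continuous_on_id]])

lemma phi_continuous:
  assumes "continuous_on UNIV \<alpha>"
  shows "continuous_on UNIV (\<lambda>z. \<phi> n (\<alpha> z, p))"
proof (rule continuous_on_compose2[OF XX_continuous assms])
  show "\<phi> n \<in> XX" using range_phi by auto
qed simp

lemma psi_continuous:
  assumes "continuous_on UNIV \<alpha>"
  shows "continuous_on UNIV (\<lambda>z. psi \<phi> n (\<alpha> z, p))"
  unfolding psi_eq fst_conv
  by (intro continuous_on_disj phi_continuous assms continuous_on_product_then_coordinatewise[OF assms])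

text \<open>On pairs of \<open>F\<close> and a sequence, the condition combines countable
  quantifiers over clopen predicates with countably many memberships in \<open>I\<close>; the
  sequence is then projected away.\<close>

lemma Sigma11_star:
  assumes "I \<noteq> {}" "Sigma11 (\<lambda>F. F \<in> I)"
  shows "Sigma11 (\<lambda>F. F \<in> star \<phi> I)"
proof -
  have agr: "continuous_on UNIV (\<lambda>z :: cantor \<times> (nat \<Rightarrow> cantor). agree (box (snd z) N) (\<phi> n) (\<phi> m))" for N n m
    by (intro continuous_on_agree_box phi_continuous continuous_on_snd_coordinate)
  have mem: "Sigma11 (\<lambda>z :: cantor \<times> (nat \<Rightarrow> cantor). snd z j \<in> I)" for j
    by (rule Sigma11_compose[OF assms(2) continuous_on_snd_coordinate])
  have avoid: "Sigma11 (\<lambda>z :: cantor \<times> (nat \<Rightarrow> cantor). fst z m \<longrightarrow> \<not> agree (box (snd z) N) (\<phi> n) (\<phi> m))" for N n m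
    by (intro Sigma11_clopen continuous_on_imp continuous_on_not continuous_on_fst_coordinate agr)
  have "Sigma11 (\<lambda>z. (\<forall>j. snd z j \<in> I) \<and> (\<forall>n N. \<exists>n' N'. agree (box (snd z) N) (\<phi> n) (\<phi> n') \<and>
      (\<forall>m. fst z m \<longrightarrow> \<not> agree (box (snd z) N') (\<phi> n') (\<phi> m))))"
    by (intro Sigma11_conj Sigma11_all Sigma11_ex mem avoid Sigma11_clopen[OF agr])
  then have "Sigma11 (\<lambda>z :: cantor \<times> (nat \<Rightarrow> cantor). (\<forall>j. snd z j \<in> I) \<and> fst z \<in> star \<phi> (range (snd z)))"
    unfolding star_range_iff .
  from Sigma11_project[OF this continuous_to_cantor_seq surj_to_cantor_seq]
  show ?thesis
    unfolding star_iff_sequence[OF assms(1)] by simp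
qed

lemma Sigma11_iter_star: "Sigma11 (\<lambda>F. F \<in> iter_star \<phi> k)"
proof (induction k)
  case 0
  then show ?case by (simp add: Sigma11_clopen)
next
  case (Suc k)
  then show ?case using Sigma11_star[OF iter_star_nonempty] by simp
qed

text \<open>An open set is coded by its index set \<open>S\<close>. A sequence in \<open>J\<close>
  with a box replaces the finite set \<open>K\<close>, so \<open>J\<close> occurs only positively,
  and the disjunction fits the closure of \<open>Sigma11\<close>.\<close>

lemma openin_Y_space_iff_sequence:
  assumes "J \<noteq> {}"
  shows "openin (Y_space \<phi> J) (psi \<phi> ` {n. S n}) \<longleftrightarrow>
    (\<forall>n. \<not> S n \<or> (\<exists>\<alpha>. (\<forall>j::nat. \<alpha> j \<in> J) \<and>
      (\<exists>N. \<forall>m. agree (box \<alpha> N) (psi \<phi> n) (psi \<phi> m) \<longrightarrow> S m)))"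
proof -
  have mem: "psi \<phi> m \<in> psi \<phi> ` {n. S n} \<longleftrightarrow> S m" for m
    using inj_image_mem_iff[OF inj_psi] by simp
  have "openin (Y_space \<phi> J) (psi \<phi> ` {n. S n}) \<longleftrightarrow>
    (\<forall>n. S n \<longrightarrow> (\<exists>K\<in>fin_coords J. \<forall>m. agree K (psi \<phi> n) (psi \<phi> m) \<longrightarrow> S m))"
    unfolding Y_space_def openin_subtopology_rho[OF assms] YY_def
    by (simp add: mem image_mono)
  moreover have "(\<exists>K\<in>fin_coords J. \<forall>m. agree K (psi \<phi> n) (psi \<phi> m) \<longrightarrow> S m) \<longleftrightarrow>
    (\<exists>\<alpha>. (\<forall>j::nat. \<alpha> j \<in> J) \<and> (\<exists>N. \<forall>m. agree (box \<alpha> N) (psi \<phi> n) (psi \<phi> m) \<longrightarrow> S m))" for n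
  proof
    assume "\<exists>K\<in>fin_coords J. \<forall>m. agree K (psi \<phi> n) (psi \<phi> m) \<longrightarrow> S m"
    then obtain K where K: "K \<in> fin_coords J" "\<forall>m. agree K (psi \<phi> n) (psi \<phi> m) \<longrightarrow> S m"
      by (elim bexE)
    \<comment> \<open>An extra element keeps the enumerated set nonempty even when \<open>K\<close>
      is empty.\<close>
    obtain j where j: "j \<in> J" using assms by blast
    let ?A = "insert j (fst ` K)"
    have A: "countable ?A" "?A \<subseteq> J"
      using j fin_coords_finite[OF K(1)] fin_coords_fst[OF K(1)] by (auto simp: countable_finite)
    have r: "range (from_nat_into ?A) = ?A" by (rule range_from_nat_into[OF _ A(1)]) simp
    have "K \<subseteq> ?A \<times> UNIV" by force
    then have "K \<in> fin_coords (range (from_nat_into ?A))"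
      using fin_coords_finite[OF K(1)] unfolding r fin_coords_def by blast
    then obtain N where N: "K \<subseteq> box (from_nat_into ?A) N"
      using fin_coords_subset_box by blast
    have "from_nat_into ?A i \<in> J" for i
      using from_nat_into[of ?A i] A(2) by blast
    moreover have "\<forall>m. agree (box (from_nat_into ?A) N) (psi \<phi> n) (psi \<phi> m) \<longrightarrow> S m"
      using K(2) agree_mono[OF N] by blast
    ultimately show "\<exists>\<alpha>. (\<forall>j::nat. \<alpha> j \<in> J) \<and> (\<exists>N. \<forall>m. agree (box \<alpha> N) (psi \<phi> n) (psi \<phi> m) \<longrightarrow> S m)"
      by (intro exI[of _ "from_nat_into ?A"]) blast
  next
    assume "\<exists>\<alpha>. (\<forall>j::nat. \<alpha> j \<in> J) \<and> (\<exists>N. \<forall>m. agree (box \<alpha> N) (psi \<phi> n) (psi \<phi> m) \<longrightarrow> S m)"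
    then obtain \<alpha> :: "nat \<Rightarrow> cantor" and N where
      "range \<alpha> \<subseteq> J" "\<forall>m. agree (box \<alpha> N) (psi \<phi> n) (psi \<phi> m) \<longrightarrow> S m" by blast
    then show "\<exists>K\<in>fin_coords J. \<forall>m. agree K (psi \<phi> n) (psi \<phi> m) \<longrightarrow> S m"
      using box_in_fin_coords by blast
  qed
  ultimately show ?thesis by simp
qed

text \<open>Being a code of an open set is a \<open>Sigma11\<close> condition on \<open>S\<close>,
  so the codes form a continuous image of the Baire space; they are then transported to the cube
  over \<open>YY \<phi>\<close>.\<close>

lemma Y_space_analytic:
  assumes "J \<noteq> {}" "Sigma11 (\<lambda>F. F \<in> J)"
  shows "has_analytic_topology (Y_space \<phi> J)"
proof -
  let ?Y = "Y_space \<phi> J"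
  let ?c = "\<lambda>S. char_fun (YY \<phi>) (psi \<phi> ` {n. S n})"
  have top: "topspace ?Y = YY \<phi>"
    unfolding Y_space_def by (rule topspace_subtopology_rho[OF assms(1)])
  have mem: "psi \<phi> m \<in> psi \<phi> ` {n. S n} \<longleftrightarrow> S m" for m S
    using inj_image_mem_iff[OF inj_psi] by simp
  have agr: "continuous_on UNIV (\<lambda>z :: cantor \<times> (nat \<Rightarrow> cantor). agree (box (snd z) N) (psi \<phi> n) (psi \<phi> m))" for N n m
    by (intro continuous_on_agree_box psi_continuous continuous_on_snd_coordinate)
  have in_J: "Sigma11 (\<lambda>z :: cantor \<times> (nat \<Rightarrow> cantor). snd z j \<in> J)" for j
    by (rule Sigma11_compose[OF assms(2) continuous_on_snd_coordinate])
  have imp: "Sigma11 (\<lambda>z :: cantor \<times> (nat \<Rightarrow> cantor). agree (box (snd z) N) (psi \<phi> n) (psi \<phi> m) \<longrightarrow> fst z m)" for N n m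
    by (intro Sigma11_clopen continuous_on_imp continuous_on_fst_coordinate agr)
  have nbhd: "Sigma11 (\<lambda>z :: cantor \<times> (nat \<Rightarrow> cantor). (\<forall>j. snd z j \<in> J) \<and>
      (\<exists>N. \<forall>m. agree (box (snd z) N) (psi \<phi> n) (psi \<phi> m) \<longrightarrow> fst z m))" for n
    by (intro Sigma11_conj Sigma11_all Sigma11_ex in_J imp)
  have nbhd': "Sigma11 (\<lambda>S. \<exists>\<alpha>. (\<forall>j. \<alpha> j \<in> J) \<and>
      (\<exists>N. \<forall>m. agree (box \<alpha> N) (psi \<phi> n) (psi \<phi> m) \<longrightarrow> S m))" for n
    using Sigma11_project[OF nbhd continuous_to_cantor_seq surj_to_cantor_seq] by simp
  have notin: "Sigma11 (\<lambda>S :: cantor. \<not> S n)" for n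
    by (intro Sigma11_clopen continuous_on_not continuous_on_product_then_coordinatewise[OF continuous_on_id])
  have opn: "Sigma11 (\<lambda>S. openin ?Y (psi \<phi> ` {n. S n}))"
    unfolding openin_Y_space_iff_sequence[OF assms(1)]
    by (intro Sigma11_all Sigma11_disj notin nbhd')
  have ex: "\<exists>S. openin ?Y (psi \<phi> ` {n. S n})"
    by (rule exI[of _ "\<lambda>_. False"]) simp
  obtain r :: "(nat \<Rightarrow> nat) \<Rightarrow> cantor" where
    r: "continuous_on UNIV r" "range r = {S. openin ?Y (psi \<phi> ` {n. S n})}"
    by (rule Sigma11_continuous_image[OF opn ex continuous_to_cantor surj_to_cantor])
  \<comment> \<open>The coordinate at \<open>psi \<phi> n\<close> of the transported function is bit
    \<open>n\<close> of the code, by injectivity of \<open>psi \<phi>\<close>.\<close>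
  have "continuous_map baire_space (cantor_cube (YY \<phi>)) (\<lambda>f. ?c (r f))"
    unfolding cantor_cube_def continuous_map_componentwise
  proof (intro conjI ballI)
    fix y assume "y \<in> YY \<phi>"
    then obtain n where n: "y = psi \<phi> n" by (auto simp: YY_def)
    have "continuous_on UNIV (\<lambda>f. r f n)"
      using r(1) by (rule continuous_on_product_then_coordinatewise)
    then show "continuous_map baire_space (discrete_topology UNIV) (\<lambda>f. ?c (r f) y)"
      unfolding baire_space_eq_euclidean discrete_topology_eq_euclidean
      by (simp add: n char_fun_def mem YY_def)
  qed (auto simp: char_fun_def)
  moreover have "(\<lambda>f. ?c (r f)) ` topspace baire_space = char_fun (YY \<phi>) ` {U. openin ?Y U}"
  proof -
    have "U \<in> (\<lambda>S. psi \<phi> ` {n. S n}) ` range r" if "openin ?Y U" for U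
    proof -
      have "U \<subseteq> range (psi \<phi>)"
        using openin_subset[OF that] top by (simp add: YY_def)
      then have "U = psi \<phi> ` {n. psi \<phi> n \<in> U}" by blast
      then show ?thesis using that unfolding r(2) by (intro image_eqI[of _ _ "\<lambda>n. psi \<phi> n \<in> U"]) auto
    qed
    then have "{U. openin ?Y U} = (\<lambda>S. psi \<phi> ` {n. S n}) ` range r"
      unfolding r(2) by blast
    then show ?thesis
      by (simp add: baire_space_eq_euclidean image_image)
  qed
  moreover have "char_fun (YY \<phi>) ` {U. openin ?Y U} \<subseteq> topspace (cantor_cube (YY \<phi>))"
    by (auto simp: cantor_cube_def char_fun_def)
  ultimately show ?thesis
    unfolding has_analytic_topology_def analytic_in_def top
    by (auto simp: YY_def)
qed

end

theorem theorem3p23: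
  fixes \<phi> :: "nat \<Rightarrow> point" and k :: nat
  assumes "enumerates_XX \<phi>" and "k > 0"
  shows "has_analytic_topology (Y_space \<phi> (iter_star \<phi> k))
    \<and> nodec_space (Y_space \<phi> (iter_star \<phi> k))
    \<and> crowded_space (Y_space \<phi> (iter_star \<phi> k))"
proof -
  interpret enumeration \<phi> using assms(1) by unfold_locales
  obtain i where k: "k = Suc i" using assms(2) gr0_implies_Suc by blast
  have sub: "star \<phi> (iter_star \<phi> i) \<subseteq> iter_star \<phi> i"
    using iter_star_Suc_subset[of i] by simp
  show ?thesis
    using Y_space_analytic[OF iter_star_nonempty Sigma11_iter_star, of k]
      Y_space_nodec[OF iter_star_nonempty sub] Y_space_crowded[OF iter_star_nonempty sub]
    by (simp add: k)
qed

end
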